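(* Let $p\in[1,\infty)$ and let $n\ge 2$ be an integer. If there exists an $L_p$-norm spherical copula (positive or circular) in dimension $n$, then $p\ge n-1$.
   Context: For $p\in[1,\infty)$ and $x\in\mathbb{R}^n$ put $\|x\|_p=(\sum_{i=1}^n|x_i|^p)^{1/p}$. If a random vector $Z$ in $\mathbb{R}^n$ has a density of the form $g(\|x\|_p)$, then $\|Z\|_p$ and $Z/\|Z\|_p$ are independent and the law of $Z/\|Z\|_p$ does not depend on $g$ (one may take, for instance, $Z$ uniformly distributed on the unit ball $\{\|x\|_p<1\}$); this law is called the $L_p$-uniform distribution on the sphere, and $U_n$ denotes a random vector with this law. Let $U_n^+$ be the vector of componentwise absolute values of $U_n$. A random vector has an $L_p$-norm spherical distribution on $\mathbb{R}^n$ if it has the same law as $R\cdot U_n$, where $R\ge 0$ is a real random variable independent of $U_n$. It has an $L_p$-norm spherical distribution on $\mathbb{R}_+^n=[0,\infty)^n$ if it has the same law as $R\cdot U_n^+$, with $R\ge0$ a real random variable independent of $U_n^+$. A copula is a probability distribution on $[0,1]^n$ all of whose univariate marginals are uniform on $(0,1)$. A copula is called a positive $L_p$-norm spherical copula if it is an $L_p$-norm spherical distribution on $\mathbb{R}_+^n$. The distribution of a random vector $(X_1^\circ,\dots,X_n^\circ)$ with marginals uniform on $(0,1)$ is called a circular $L_p$-norm spherical copula if $(2X_1^\circ-1,\dots,2X_n^\circ-1)$ has an $L_p$-norm spherical distribution on $\mathbb{R}^n$. *)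

theory Defs
  imports "HOL-Probability.Probability"
begin

definition lp_norm :: "real \<Rightarrow> real ^ 'n \<Rightarrow> real" where
  "lp_norm p x = (\<Sum>i\<in>UNIV. \<bar>x $ i\<bar> powr p) powr (1 / p)"

text \<open>The law of \<open>Z / \<parallel>Z\<parallel>\<^sub>p\<close> for \<open>Z\<close> uniform on the open \<open>L\<^sub>p\<close> unit ball; the same law arises from
  every \<open>Z\<close> whose density is a function of \<open>\<parallel>x\<parallel>\<^sub>p\<close>. The origin, where the quotient is not
  meaningful, is a null set.\<close>

definition lp_uniform :: "real \<Rightarrow> (real ^ 'n) measure" where
  "lp_uniform p =
     distr (uniform_measure lborel {x. lp_norm p x < 1}) borel (\<lambda>z. z /\<^sub>R lp_norm p z)"

definition lp_uniform_pos :: "real \<Rightarrow> (real ^ 'n) measure" where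
  "lp_uniform_pos p = distr (lp_uniform p) borel (\<lambda>u. \<chi> i. \<bar>u $ i\<bar>)"

text \<open>\<open>D\<close> is the law of \<open>R \<cdot> V\<close> with \<open>V\<close> distributed according to \<open>\<nu>\<close> and \<open>R \<ge> 0\<close> a real random
  variable independent of \<open>V\<close>. Here \<open>\<rho>\<close> is the law of \<open>R\<close>; independence says that the joint law
  of \<open>(R, V)\<close> is the product measure.\<close>

definition independent_scaling :: "(real ^ 'n) measure \<Rightarrow> (real ^ 'n) measure \<Rightarrow> bool" where
  "independent_scaling \<nu> D \<longleftrightarrow>
     (\<exists>\<rho> :: real measure. prob_space \<rho> \<and> sets \<rho> = sets borel \<and> (AE r in \<rho>. 0 \<le> r) \<and>
        D = distr (\<rho> \<Otimes>\<^sub>M \<nu>) borel (\<lambda>(r, v). r *\<^sub>R v))"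

definition lp_spherical :: "real \<Rightarrow> (real ^ 'n) measure \<Rightarrow> bool" where
  "lp_spherical p D \<longleftrightarrow> independent_scaling (lp_uniform p) D"

definition lp_spherical_pos :: "real \<Rightarrow> (real ^ 'n) measure \<Rightarrow> bool" where
  "lp_spherical_pos p D \<longleftrightarrow> independent_scaling (lp_uniform_pos p) D"

definition copula :: "(real ^ 'n) measure \<Rightarrow> bool" where
  "copula C \<longleftrightarrow> prob_space C \<and> sets C = sets borel \<and>
     (AE x in C. \<forall>i. x $ i \<in> {0..1}) \<and>
     (\<forall>i. distr C borel (\<lambda>x. x $ i) = uniform_measure lborel {0<..<1})"

definition positive_lp_spherical_copula :: "real \<Rightarrow> (real ^ 'n) measure \<Rightarrow> bool" where
  "positive_lp_spherical_copula p C \<longleftrightarrow> copula C \<and> lp_spherical_pos p C"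

definition circular_lp_spherical_copula :: "real \<Rightarrow> (real ^ 'n) measure \<Rightarrow> bool" where
  "circular_lp_spherical_copula p C \<longleftrightarrow>
     copula C \<and> lp_spherical p (distr C borel (\<lambda>x. \<chi> i. 2 * x $ i - 1))"

end

theory Submission
  imports Defs
begin

text \<open>If \<open>X = R \<cdot> U\<close> has coordinates whose absolute values are uniform on \<open>(0, 1)\<close>, then \<open>R \<le> 1\<close>
  almost surely, because \<open>\<bar>U\<^sub>i\<bar>\<close> comes arbitrarily close to \<open>1\<close> with positive probability. Hence
  \<open>\<epsilon> = P(\<bar>X\<^sub>i\<bar> > 1 - \<epsilon>) \<le> P(\<bar>U\<^sub>i\<bar> > 1 - \<epsilon>)\<close>. By Bernoulli's inequality, a point \<open>z\<close> of the unit ball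
  with \<open>\<bar>z\<^sub>i\<bar> > (1 - \<epsilon>) \<parallel>z\<parallel>\<^sub>p\<close> satisfies \<open>\<bar>z\<^sub>j\<bar>\<^sup>p \<le> p \<epsilon>\<close> for all \<open>j \<noteq> i\<close>; so the right-hand side is at
  most a constant times \<open>\<epsilon> powr ((n - 1) / p)\<close>. Letting \<open>\<epsilon> \<longlongrightarrow> 0\<close> forces \<open>(n - 1) / p \<le> 1\<close>.\<close>

section \<open>Bernoulli's inequality for real exponents and basic facts on the \<open>L_p\<close>
  norm\<close>

lemma Bernoulli_inequality_powr:
  fixes p e :: real
  assumes "1 \<le> p" "e < 1"
  shows "1 - p * e \<le> (1 - e) powr p"
proof -
  \<comment> \<open>The convex function \<open>x powr p\<close> lies above its tangent at
    \<open>1\<close>; the point \<open>1 - e\<close> stays in the domain \<open>{0<..}\<close>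
    because \<open>e < 1\<close>.\<close>
  have "((\<lambda>x. x powr p) has_real_derivative p * 1 powr (p - 1)) (at 1 within {0<..})"
    by (auto intro!: derivative_eq_intros)
  then have "p * 1 powr (p - 1) * ((1 - e) - 1) \<le> (1 - e) powr p - 1 powr p"
    using convex_on_imp_above_tangent[OF powr_convex[OF assms(1)], of 1 "1 - e"] assms(2)
    by (simp add: interior_open)
  then show ?thesis by (simp add: algebra_simps)
qed

lemma lp_norm_nonneg [simp]: "0 \<le> lp_norm p x"
  by (simp add: lp_norm_def)

lemma lp_norm_powr:
  assumes "0 < p"
  shows "lp_norm p x powr p = (\<Sum>i\<in>UNIV. \<bar>x $ i\<bar> powr p)"
  using assms by (simp add: lp_norm_def powr_powr sum_nonneg)

lemma abs_nth_le_lp_norm: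
  fixes x :: "real ^ 'n::finite"
  assumes "0 < p"
  shows "\<bar>x $ i\<bar> \<le> lp_norm p x"
proof -
  have "\<bar>x $ i\<bar> powr p \<le> lp_norm p x powr p"
    unfolding lp_norm_powr[OF assms] by (rule member_le_sum) auto
  then show ?thesis
    using assms by (meson lp_norm_nonneg not_le powr_less_mono2)
qed

lemma lp_norm_axis:
  assumes "0 < p"
  shows "lp_norm p (axis i c :: real ^ 'n::finite) = \<bar>c\<bar>"
proof -
  have "(\<Sum>j\<in>UNIV. \<bar>(axis i c :: real ^ 'n) $ j\<bar> powr p) = (\<Sum>j\<in>UNIV. if j = i then \<bar>c\<bar> powr p else 0)"
    by (rule sum.cong) (auto simp: axis_def)
  then show ?thesis
    using assms by (simp add: lp_norm_def powr_powr)
qed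

lemma continuous_on_lp_norm:
  assumes "0 < p"
  shows "continuous_on UNIV (lp_norm p :: real ^ 'n::finite \<Rightarrow> real)"
  unfolding lp_norm_def using assms
  by (intro continuous_intros continuous_on_powr') (auto intro!: sum_nonneg)

lemma borel_measurable_lp_norm [measurable]: "lp_norm p \<in> borel_measurable borel"
  unfolding lp_norm_def by measurable

section \<open>Volume of the unit ball and caps of the \<open>L_p\<close>-uniform law\<close>

lemma emeasure_lborel_open_pos:
  fixes S :: "'a::euclidean_space set"
  assumes "open S" "S \<noteq> {}"
  shows "0 < emeasure lborel S"
  using open_not_negligible[OF assms] assms(1)
  by (auto simp: negligible_iff_emeasure0 zero_less_iff_neq_zero)

lemma open_lp_ball:
  assumes "0 < p"
  shows "open {x :: real ^ 'n::finite. lp_norm p x < 1}"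
  using assms by (intro open_Collect_less continuous_on_lp_norm continuous_intros)

text \<open>The ball is a nonempty open set inside a cube. Both claims are what makes normalised
  Lebesgue measure on it a probability measure.\<close>

lemma emeasure_lp_ball:
  fixes p :: real
  defines "B \<equiv> {x :: real ^ 'n::finite. lp_norm p x < 1}"
  assumes "0 < p"
  shows "emeasure lborel B \<noteq> 0" "emeasure lborel B \<noteq> \<infinity>"
proof -
  have "(0 :: real ^ 'n) \<in> B"
    by (simp add: B_def lp_norm_def)
  moreover have "open B"
    unfolding B_def using assms(2) by (rule open_lp_ball)
  ultimately have "0 < emeasure lborel B"
    by (intro emeasure_lborel_open_pos) auto
  then show "emeasure lborel B \<noteq> 0"
    by simp
  have "B \<subseteq> cbox (- 1) 1"
  proof
    fix x assume "x \<in> B"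
    then have "\<bar>x $ i\<bar> \<le> 1" for i
      using abs_nth_le_lp_norm[OF assms(2), of x i] by (auto simp: B_def)
    then show "x \<in> cbox (- 1) 1"
      by (auto simp: mem_box_cart abs_le_iff minus_le_iff)
  qed
  then have "emeasure lborel B \<le> emeasure lborel (cbox (- 1) 1 :: (real ^ 'n) set)"
    by (rule emeasure_mono) simp
  then show "emeasure lborel B \<noteq> \<infinity>"
    using emeasure_lborel_cbox_finite[of "- 1" "1 :: real ^ 'n"] by (auto simp: top_unique)
qed

lemma prob_space_lp_uniform:
  assumes "0 < p"
  shows "prob_space (lp_uniform p :: (real ^ 'n::finite) measure)"
proof -
  interpret prob_space "uniform_measure lborel {x :: real ^ 'n. lp_norm p x < 1}"
    using emeasure_lp_ball[OF assms] by (intro prob_space_uniform_measure) auto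
  show ?thesis
    unfolding lp_uniform_def by (rule prob_space_distr) measurable
qed

text \<open>Clearing the norm from the denominator turns a cap of the sphere into the part of the
  ball in a cone, so its probability is a ratio of volumes.\<close>

lemma emeasure_lp_uniform_cap:
  fixes i :: "'n::finite"
  assumes "0 < p" "0 \<le> a"
  shows "emeasure (lp_uniform p) {u :: real ^ 'n. a < \<bar>u $ i\<bar>} =
    emeasure lborel {z :: real ^ 'n. lp_norm p z < 1 \<and> a * lp_norm p z < \<bar>z $ i\<bar>} /
    emeasure lborel {z :: real ^ 'n. lp_norm p z < 1}"
proof -
  have "(a < \<bar>(z /\<^sub>R lp_norm p z) $ i\<bar>) = (a * lp_norm p z < \<bar>z $ i\<bar>)" for z :: "real ^ 'n"
  proof (cases "lp_norm p z = 0")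
    \<comment> \<open>At the origin the quotient is \<open>0\<close> by the convention
      \<open>inverse 0 = 0\<close>; since \<open>0 \<le> a\<close>, both inequalities fail
      there.\<close>
    case True
    then show ?thesis
      using assms abs_nth_le_lp_norm[OF assms(1), of z i] by simp
  next
    case False
    then have "0 < lp_norm p z"
      using lp_norm_nonneg[of p z] by linarith
    then show ?thesis
      by (simp add: abs_mult field_simps)
  qed
  then have "(\<lambda>z. z /\<^sub>R lp_norm p z) -` {u :: real ^ 'n. a < \<bar>u $ i\<bar>} =
      {z. a * lp_norm p z < \<bar>z $ i\<bar>}"
    by auto
  then have "emeasure (lp_uniform p) {u :: real ^ 'n. a < \<bar>u $ i\<bar>} =
      emeasure (uniform_measure lborel {x. lp_norm p x < 1}) {z. a * lp_norm p z < \<bar>z $ i\<bar>}"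
    unfolding lp_uniform_def by (subst emeasure_distr) auto
  also have "\<dots> = emeasure lborel {z :: real ^ 'n. lp_norm p z < 1 \<and> a * lp_norm p z < \<bar>z $ i\<bar>} /
    emeasure lborel {z :: real ^ 'n. lp_norm p z < 1}"
    by (simp add: Collect_conj_eq)
  finally show ?thesis .
qed

text \<open>The cone inside the ball is open, and half the \<open>i\<close>-th unit vector lies in
  it since \<open>a < 1\<close>; hence it has positive volume.\<close>

lemma lp_uniform_cap_pos:
  fixes i :: "'n::finite"
  assumes "0 < p" "0 \<le> a" "a < 1"
  shows "0 < emeasure (lp_uniform p) {u :: real ^ 'n. a < \<bar>u $ i\<bar>}"
proof -
  let ?S = "{z :: real ^ 'n. lp_norm p z < 1 \<and> a * lp_norm p z < \<bar>z $ i\<bar>}"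
  have "axis i (1/2) \<in> ?S"
    using assms by (simp add: lp_norm_axis)
  moreover have "open ?S"
    using assms
    by (intro open_Collect_conj open_Collect_less continuous_on_lp_norm continuous_intros)
  ultimately have "0 < emeasure lborel ?S"
    by (intro emeasure_lborel_open_pos) auto
  then show ?thesis
    using assms emeasure_lp_ball(2)[OF assms(1), where 'n = 'n]
    by (simp add: emeasure_lp_uniform_cap zero_less_iff_neq_zero ennreal_divide_eq_0_iff)
qed

section \<open>Upper bound for the probability of a small cap\<close>

text \<open>If the \<open>i\<close>-th coordinate carries nearly all of the norm, little is left for
  the others. The box is thin in all directions but one, which yields the exponent
  \<open>(n - 1) / p\<close> of the volume bound.\<close>

lemma lp_ball_cap_subset_cbox:
  fixes i :: "'n::finite"
  assumes "1 \<le> p" "0 < e" "e < 1"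
  defines "c \<equiv> \<chi> j. if j = i then 1 else (p * e) powr (1 / p)"
  shows "{z :: real ^ 'n. lp_norm p z < 1 \<and> (1 - e) * lp_norm p z < \<bar>z $ i\<bar>} \<subseteq> cbox (- c) c"
proof
  fix z :: "real ^ 'n"
  assume "z \<in> {z. lp_norm p z < 1 \<and> (1 - e) * lp_norm p z < \<bar>z $ i\<bar>}"
  then have z: "lp_norm p z < 1" "(1 - e) * lp_norm p z < \<bar>z $ i\<bar>"
    by auto
  have p: "0 < p"
    using assms by simp
  have "\<bar>z $ j\<bar> \<le> c $ j" for j
  proof (cases "j = i")
    case True
    then show ?thesis
      using abs_nth_le_lp_norm[OF p, of z i] z by (simp add: c_def)
  next
    case False
    \<comment> \<open>Bernoulli's inequality makes the defect of the \<open>p\<close>-th powers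
      linear in \<open>e\<close>.\<close>
    have "(1 - p * e) * lp_norm p z powr p \<le> ((1 - e) * lp_norm p z) powr p"
      using Bernoulli_inequality_powr[OF assms(1,3)] assms
      by (simp add: powr_mult mult_right_mono)
    also have "\<dots> \<le> \<bar>z $ i\<bar> powr p"
      using z assms by (intro powr_mono2) auto
    finally have "lp_norm p z powr p - \<bar>z $ i\<bar> powr p \<le> p * e * lp_norm p z powr p"
      by (simp add: algebra_simps)
    also have "\<dots> \<le> p * e"
      using z p assms(2) by (intro mult_left_le powr_le1) auto
    finally have "lp_norm p z powr p - \<bar>z $ i\<bar> powr p \<le> p * e" .
    \<comment> \<open>Two distinct terms of the sum of \<open>p\<close>-th powers: what the
      \<open>i\<close>-th leaves over bounds the \<open>j\<close>-th.\<close>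
    moreover have "\<bar>z $ i\<bar> powr p + \<bar>z $ j\<bar> powr p \<le> lp_norm p z powr p"
      unfolding lp_norm_powr[OF p]
      using sum_mono2[of UNIV "{i, j}" "\<lambda>k. \<bar>z $ k\<bar> powr p"] False by auto
    ultimately have "\<bar>z $ j\<bar> powr p \<le> p * e"
      by simp
    then have "(\<bar>z $ j\<bar> powr p) powr (1 / p) \<le> (p * e) powr (1 / p)"
      using p by (intro powr_mono2) auto
    then show ?thesis
      using False p by (simp add: c_def powr_powr)
  qed
  then show "z \<in> cbox (- c) c"
    by (auto simp: mem_box_cart abs_le_iff minus_le_iff)
qed

lemma emeasure_cbox_cap:
  fixes i :: "'n::finite"
  assumes "0 \<le> d"
  defines "c \<equiv> \<chi> j. if j = i then 1 else d"
  shows "emeasure lborel (cbox (- c) c :: (real ^ 'n) set) =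
    ennreal (2 ^ CARD('n) * d ^ (CARD('n) - 1))"
proof -
  have "cbox (- c) c \<noteq> {}"
    using assms by (auto simp: interval_ne_empty_cart c_def)
  then have "measure lborel (cbox (- c) c) = (\<Prod>j\<in>UNIV. c $ j - (- c) $ j)"
    by (rule content_cbox_cart)
  also have "\<dots> = (\<Prod>j\<in>UNIV. 2 * c $ j)"
    by simp
  also have "\<dots> = 2 ^ CARD('n) * (\<Prod>j\<in>UNIV. c $ j)"
    by (simp add: prod.distrib)
  also have "(\<Prod>j\<in>UNIV. c $ j) = c $ i * (\<Prod>j\<in>UNIV - {i}. c $ j)"
    by (rule prod.remove) auto
  also have "\<dots> = d ^ (CARD('n) - 1)"
    by (simp add: c_def card_Diff_singleton)
  finally have "measure lborel (cbox (- c) c) = 2 ^ CARD('n) * d ^ (CARD('n) - 1)" .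
  moreover have "emeasure lborel (cbox (- c) c) = ennreal (measure lborel (cbox (- c) c))"
    using emeasure_lborel_cbox_finite[of "- c" c] by (intro emeasure_eq_ennreal_measure) auto
  ultimately show ?thesis
    by simp
qed

lemma lp_uniform_cap_bound:
  fixes i :: "'n::finite"
  assumes "1 \<le> p"
  obtains K where "0 < K"
    "\<And>e. 0 < e \<Longrightarrow> e < 1 \<Longrightarrow> emeasure (lp_uniform p) {u :: real ^ 'n. 1 - e < \<bar>u $ i\<bar>} \<le>
      ennreal (K * e powr ((real CARD('n) - 1) / p))"
proof
  define V where "V = measure lborel {z :: real ^ 'n. lp_norm p z < 1}"
  \<comment> \<open>The volume of the enclosing box with its power of \<open>e\<close> removed,
    divided by the volume of the ball.\<close>
  define K where "K = 2 ^ CARD('n) * p powr ((real CARD('n) - 1) / p) / V"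
  have p: "0 < p"
    using assms by simp
  have V: "emeasure lborel {z :: real ^ 'n. lp_norm p z < 1} = ennreal V"
    using emeasure_lp_ball(2)[OF p] unfolding V_def
    by (intro emeasure_eq_ennreal_measure) auto
  then have "V \<noteq> 0"
    using emeasure_lp_ball(1)[OF p, where 'n = 'n] by auto
  then have V_pos: "0 < V"
    by (simp add: V_def zero_less_measure_iff)
  then show "0 < K"
    using p by (simp add: K_def)
  fix e :: real
  assume e: "0 < e" "e < 1"
  define d where "d = (p * e) powr (1 / p)"
  have d: "0 < d"
    using p e by (simp add: d_def)
  \<comment> \<open>The subtraction of naturals on the left is exact because \<open>CARD('n)\<close>
    is at least \<open>1\<close>.\<close>
  have "d ^ (CARD('n) - 1) = d powr (real CARD('n) - 1)"
    using d by (simp add: powr_realpow[symmetric] of_nat_diff Suc_leI)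
  also have "\<dots> = p powr ((real CARD('n) - 1) / p) * e powr ((real CARD('n) - 1) / p)"
    using p e by (simp add: d_def powr_powr powr_mult)
  finally have *: "2 ^ CARD('n) * d ^ (CARD('n) - 1) / V = K * e powr ((real CARD('n) - 1) / p)"
    by (simp add: K_def)
  have "emeasure lborel {z :: real ^ 'n. lp_norm p z < 1 \<and> (1 - e) * lp_norm p z < \<bar>z $ i\<bar>}
      \<le> ennreal (2 ^ CARD('n) * d ^ (CARD('n) - 1))"
    using emeasure_mono[OF lp_ball_cap_subset_cbox[OF assms e, of i], of lborel]
      emeasure_cbox_cap[of d i] d unfolding d_def by simp
  then have "emeasure (lp_uniform p) {u :: real ^ 'n. 1 - e < \<bar>u $ i\<bar>} \<le>
      ennreal (2 ^ CARD('n) * d ^ (CARD('n) - 1)) / ennreal V"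
    using e p by (simp add: emeasure_lp_uniform_cap V divide_right_mono_ennreal)
  also have "\<dots> = ennreal (K * e powr ((real CARD('n) - 1) / p))"
    using V_pos d by (simp add: divide_ennreal flip: *)
  finally show "emeasure (lp_uniform p) {u :: real ^ 'n. 1 - e < \<bar>u $ i\<bar>} \<le>
      ennreal (K * e powr ((real CARD('n) - 1) / p))" .
qed

section \<open>Comparison of the tails of a scaled vector and of its direction\<close>

text \<open>Once the radius is at most \<open>1\<close> almost surely, scaling cannot enlarge a
  coordinate. Leaving \<open>\<nu>\<close> general covers \<open>lp_uniform\<close> and
  \<open>lp_uniform_pos\<close> by one argument.\<close>

lemma independent_scaling_tail_le:
  fixes \<nu> D :: "(real ^ 'n::finite) measure"
  assumes scaling: "independent_scaling \<nu> D"
    and \<nu>: "prob_space \<nu>" "sets \<nu> = sets borel"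
    and cap: "\<And>a. 0 \<le> a \<Longrightarrow> a < 1 \<Longrightarrow> 0 < emeasure \<nu> {v. a < \<bar>v $ i\<bar>}"
    and D: "emeasure D {x. 1 < \<bar>x $ i\<bar>} = 0"
    and a: "0 \<le> a"
  shows "emeasure D {x. a < \<bar>x $ i\<bar>} \<le> emeasure \<nu> {v. a < \<bar>v $ i\<bar>}"
proof -
  obtain \<rho> :: "real measure" where \<rho>: "prob_space \<rho>" "sets \<rho> = sets borel" "AE r in \<rho>. 0 \<le> r"
    and D_eq: "D = distr (\<rho> \<Otimes>\<^sub>M \<nu>) borel (\<lambda>(r, v). r *\<^sub>R v)"
    using scaling by (auto simp: independent_scaling_def)
  interpret \<rho>: prob_space \<rho> by fact
  interpret \<nu>: prob_space \<nu> by fact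
  interpret P: pair_prob_space \<rho> \<nu> ..
  note [measurable_cong] = \<rho>(2) \<nu>(2)
  have space [simp]: "space \<rho> = UNIV" "space \<nu> = UNIV"
    using \<rho>(2) \<nu>(2) by (auto dest: sets_eq_imp_space_eq)
  have [measurable]: "(\<lambda>v :: real ^ 'n. v $ i) \<in> borel_measurable borel"
    by (intro borel_measurable_continuous_onI continuous_intros)
  have [measurable]: "(\<lambda>(r, v). r *\<^sub>R v) \<in> \<rho> \<Otimes>\<^sub>M \<nu> \<rightarrow>\<^sub>M borel"
    by measurable
  have D_tail: "emeasure D {x. b < \<bar>x $ i\<bar>} =
      emeasure (\<rho> \<Otimes>\<^sub>M \<nu>) {w \<in> space (\<rho> \<Otimes>\<^sub>M \<nu>). b < \<bar>fst w * snd w $ i\<bar>}" for b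
    unfolding D_eq
    by (subst emeasure_distr)
      (auto simp: space_pair_measure intro!: arg_cong2[where f = emeasure])
  \<comment> \<open>On the rectangle \<open>t < r\<close>, \<open>1 / t < \<bar>v $ i\<bar>\<close>
    the product exceeds \<open>1\<close>, so the rectangle is null. By independence its measure is a
    product, whose second factor is positive by \<open>cap\<close>.\<close>
  have null: "emeasure \<rho> {r. t < r} = 0" if t: "1 < t" for t
  proof -
    have "emeasure \<rho> {r. t < r} * emeasure \<nu> {v. 1 / t < \<bar>v $ i\<bar>} =
        emeasure (\<rho> \<Otimes>\<^sub>M \<nu>) ({r. t < r} \<times> {v. 1 / t < \<bar>v $ i\<bar>})"
      by (rule \<nu>.emeasure_pair_measure_Times[symmetric]) (auto simp: \<rho>(2) \<nu>(2))
    also have "\<dots> \<le> emeasure D {x. 1 < \<bar>x $ i\<bar>}"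
      unfolding D_tail
    proof (rule emeasure_mono)
      show "{r. t < r} \<times> {v. 1 / t < \<bar>v $ i\<bar>} \<subseteq>
          {w \<in> space (\<rho> \<Otimes>\<^sub>M \<nu>). 1 < \<bar>fst w * snd w $ i\<bar>}"
      proof clarify
        fix r :: real and v :: "real ^ 'n"
        assume rv: "t < r" "1 / t < \<bar>v $ i\<bar>"
        have "1 < t * \<bar>v $ i\<bar>"
          using rv(2) t by (simp add: divide_less_eq mult.commute)
        also have "\<dots> \<le> r * \<bar>v $ i\<bar>"
          using rv(1) by (intro mult_right_mono) auto
        finally show "(r, v) \<in> space (\<rho> \<Otimes>\<^sub>M \<nu>) \<and> 1 < \<bar>fst (r, v) * snd (r, v) $ i\<bar>"
          using rv(1) t by (simp add: space_pair_measure abs_mult)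
      qed
    qed measurable
    finally have "emeasure \<rho> {r. t < r} * emeasure \<nu> {v. 1 / t < \<bar>v $ i\<bar>} = 0"
      using D by simp
    moreover have "emeasure \<nu> {v. 1 / t < \<bar>v $ i\<bar>} \<noteq> 0"
      using cap[of "1 / t"] t by (simp add: divide_less_eq)
    ultimately show ?thesis
      by simp
  qed
  \<comment> \<open>The set \<open>1 < r\<close> is exhausted by countably many of the null sets
    just obtained.\<close>
  have "AE r in \<rho>. \<forall>m. \<not> 1 + 1 / real (Suc m) < r"
    unfolding AE_all_countable
  proof
    fix m
    show "AE r in \<rho>. \<not> 1 + 1 / real (Suc m) < r"
      using null[of "1 + 1 / real (Suc m)"]
      by (subst AE_iff_measurable[OF _ refl]) (auto simp: \<rho>(2))
  qed
  then have "AE r in \<rho>. \<bar>r\<bar> \<le> 1"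
    using \<rho>(3)
  proof eventually_elim
    case (elim r)
    have "r \<le> 1"
    proof (rule ccontr)
      assume "\<not> r \<le> 1"
      then obtain m where "inverse (real (Suc m)) < r - 1"
        using reals_Archimedean[of "r - 1"] by auto
      then show False
        using elim(1) by (auto simp: inverse_eq_divide dest: spec[of _ m])
    qed
    then show ?case
      using elim(2) by simp
  qed
  then have one: "emeasure \<rho> {r. \<not> \<bar>r\<bar> \<le> 1} = 0"
    by (subst (asm) AE_iff_measurable[OF _ refl]) (auto simp: \<rho>(2))
  \<comment> \<open>A product above \<open>a\<close> needs either a radius outside
    \<open>[-1, 1]\<close>, which is a null event, or a direction already in the cap.\<close>
  have "emeasure D {x. a < \<bar>x $ i\<bar>} \<le>
      emeasure (\<rho> \<Otimes>\<^sub>M \<nu>) ({r. \<not> \<bar>r\<bar> \<le> 1} \<times> UNIV \<union> UNIV \<times> {v. a < \<bar>v $ i\<bar>})"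
    unfolding D_tail
  proof (rule emeasure_mono)
    show "{w \<in> space (\<rho> \<Otimes>\<^sub>M \<nu>). a < \<bar>fst w * snd w $ i\<bar>} \<subseteq>
        {r. \<not> \<bar>r\<bar> \<le> 1} \<times> UNIV \<union> UNIV \<times> {v. a < \<bar>v $ i\<bar>}"
    proof
      fix w
      assume "w \<in> {w \<in> space (\<rho> \<Otimes>\<^sub>M \<nu>). a < \<bar>fst w * snd w $ i\<bar>}"
      then have "a < \<bar>snd w $ i\<bar>" if "\<bar>fst w\<bar> \<le> 1"
        using mult_right_mono[OF that, of "\<bar>snd w $ i\<bar>"] by (simp add: abs_mult)
      then show "w \<in> {r. \<not> \<bar>r\<bar> \<le> 1} \<times> UNIV \<union> UNIV \<times> {v. a < \<bar>v $ i\<bar>}"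
        by (cases w) auto
    qed
  qed (auto simp: \<rho>(2) \<nu>(2) intro!: sets.Un pair_measureI)
  also have "\<dots> \<le> emeasure (\<rho> \<Otimes>\<^sub>M \<nu>) ({r. \<not> \<bar>r\<bar> \<le> 1} \<times> UNIV) +
      emeasure (\<rho> \<Otimes>\<^sub>M \<nu>) (UNIV \<times> {v. a < \<bar>v $ i\<bar>})"
    by (rule emeasure_subadditive) (auto simp: \<rho>(2) \<nu>(2) intro!: pair_measureI)
  also have "\<dots> =
      emeasure \<rho> {r. \<not> \<bar>r\<bar> \<le> 1} * emeasure \<nu> UNIV +
      emeasure \<rho> UNIV * emeasure \<nu> {v. a < \<bar>v $ i\<bar>}"
    by (intro arg_cong2[where f = plus] \<nu>.emeasure_pair_measure_Times) (auto simp: \<rho>(2) \<nu>(2))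
  also have "\<dots> = emeasure \<nu> {v. a < \<bar>v $ i\<bar>}"
    using one \<rho>.emeasure_space_1 by simp
  finally show ?thesis .
qed

text \<open>Caps are defined through \<open>\<bar>u $ i\<bar>\<close>, which does not change when
  all components are replaced by their absolute values.\<close>

lemma emeasure_lp_uniform_pos_cap:
  "emeasure (lp_uniform_pos p) {u :: real ^ 'n::finite. a < \<bar>u $ i\<bar>} =
    emeasure (lp_uniform p) {u :: real ^ 'n. a < \<bar>u $ i\<bar>}"
proof -
  have "(\<lambda>u :: real ^ 'n. \<chi> i. \<bar>u $ i\<bar>) \<in> borel_measurable borel"
    by (intro borel_measurable_continuous_onI continuous_intros)
  then have "emeasure (lp_uniform_pos p) {u :: real ^ 'n. a < \<bar>u $ i\<bar>} =
      emeasure (lp_uniform p) ((\<lambda>u. \<chi> i. \<bar>u $ i\<bar>) -` {u. a < \<bar>u $ i\<bar>} \<inter> space (lp_uniform p))"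
    unfolding lp_uniform_pos_def
    by (intro emeasure_distr) (auto simp: lp_uniform_def)
  then show ?thesis
    by (simp add: lp_uniform_def)
qed

text \<open>Brings the positive and the circular case under the same bound.\<close>

lemma spherical_uniform_tail_le:
  fixes D :: "(real ^ 'n::finite) measure"
  assumes "0 < p" and D: "lp_spherical_pos p D \<or> lp_spherical p D"
    and "emeasure D {x. 1 < \<bar>x $ i\<bar>} = 0" and "0 \<le> a"
  shows "emeasure D {x. a < \<bar>x $ i\<bar>} \<le> emeasure (lp_uniform p) {u :: real ^ 'n. a < \<bar>u $ i\<bar>}"
  using D
proof
  assume "lp_spherical p D"
  then show ?thesis
    unfolding lp_spherical_def using assms
    by (intro independent_scaling_tail_le prob_space_lp_uniform lp_uniform_cap_pos)
      (auto simp: lp_uniform_def)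
next
  have abs: "(\<lambda>u :: real ^ 'n. \<chi> i. \<bar>u $ i\<bar>) \<in> borel_measurable borel"
    by (intro borel_measurable_continuous_onI continuous_intros)
  interpret prob_space "lp_uniform p :: (real ^ 'n) measure"
    using assms(1) by (rule prob_space_lp_uniform)
  have "prob_space (lp_uniform_pos p :: (real ^ 'n) measure)"
    unfolding lp_uniform_pos_def
    by (rule prob_space_distr) (use abs in \<open>simp add: lp_uniform_def\<close>)
  moreover assume "lp_spherical_pos p D"
  ultimately have "emeasure D {x. a < \<bar>x $ i\<bar>} \<le>
      emeasure (lp_uniform_pos p) {u :: real ^ 'n. a < \<bar>u $ i\<bar>}"
    unfolding lp_spherical_pos_def using assms
    by (intro independent_scaling_tail_le)
      (auto simp: emeasure_lp_uniform_pos_cap lp_uniform_cap_pos, auto simp: lp_uniform_pos_def)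
  then show ?thesis
    by (simp add: emeasure_lp_uniform_pos_cap)
qed

section \<open>Tails of the coordinates of a copula, plain and centred\<close>

lemma copula_marginal:
  fixes C :: "(real ^ 'n::finite) measure"
  assumes "copula C" and "S \<in> sets borel"
  shows "emeasure C {x. x $ i \<in> S} = emeasure lborel ({0<..<1} \<inter> S)"
proof -
  have C: "sets C = sets borel" "distr C borel (\<lambda>x. x $ i) = uniform_measure lborel {0<..<1}"
    using assms(1) by (auto simp: copula_def)
  have "space C = UNIV"
    using C(1) by (auto dest: sets_eq_imp_space_eq)
  moreover have "(\<lambda>x. x $ i) \<in> borel_measurable C"
    by (simp add: measurable_cong_sets[OF C(1) refl])
  ultimately have "emeasure C {x. x $ i \<in> S} = emeasure (distr C borel (\<lambda>x. x $ i)) S"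
    using assms(2) by (subst emeasure_distr) (auto intro!: arg_cong2[where f = emeasure])
  also have "\<dots> = emeasure lborel ({0<..<1} \<inter> S)"
    unfolding C(2) using assms(2) by (simp add: divide_ennreal_def)
  finally show ?thesis .
qed

lemma copula_abs_tail:
  fixes C :: "(real ^ 'n::finite) measure"
  assumes "copula C"
  shows "emeasure C {x. 1 < \<bar>x $ i\<bar>} = 0"
    and "0 \<le> a \<Longrightarrow> a \<le> 1 \<Longrightarrow> emeasure C {x. a < \<bar>x $ i\<bar>} = ennreal (1 - a)"
proof -
  have tail: "emeasure C {x. b < \<bar>x $ i\<bar>} = emeasure lborel ({0<..<1} \<inter> {y. b < \<bar>y\<bar>})" for b
    using copula_marginal[OF assms, of "{y. b < \<bar>y\<bar>}" i] by simp
  have "{0<..<1} \<inter> {y. 1 < \<bar>y\<bar>} = ({} :: real set)"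
    by auto
  then show "emeasure C {x. 1 < \<bar>x $ i\<bar>} = 0"
    by (simp add: tail)
  assume a: "0 \<le> a" "a \<le> 1"
  then have "{0<..<1} \<inter> {y. a < \<bar>y\<bar>} = {a<..<1}"
    by auto
  then show "emeasure C {x. a < \<bar>x $ i\<bar>} = ennreal (1 - a)"
    using a by (simp add: tail)
qed

text \<open>If \<open>y\<close> is uniform on \<open>(0, 1)\<close>, then so is
  \<open>\<bar>2 * y - 1\<bar>\<close>; the tails thus agree with those in
  \<open>copula_abs_tail\<close>.\<close>

lemma copula_centred_abs_tail:
  fixes C :: "(real ^ 'n::finite) measure"
  assumes "copula C"
  defines "D \<equiv> distr C borel (\<lambda>x. \<chi> i. 2 * x $ i - 1)"
  shows "emeasure D {x. 1 < \<bar>x $ i\<bar>} = 0"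
    and "0 \<le> a \<Longrightarrow> a \<le> 1 \<Longrightarrow> emeasure D {x. a < \<bar>x $ i\<bar>} = ennreal (1 - a)"
proof -
  have C: "sets C = sets borel"
    using assms(1) by (auto simp: copula_def)
  have "(\<lambda>x :: real ^ 'n. \<chi> i. 2 * x $ i - 1) \<in> borel_measurable borel"
    by (intro borel_measurable_continuous_onI continuous_intros)
  then have "emeasure D {x. b < \<bar>x $ i\<bar>} = emeasure C {x. x $ i \<in> {y. b < \<bar>2 * y - 1\<bar>}}" for b
    unfolding D_def using sets_eq_imp_space_eq[OF C]
    by (subst emeasure_distr)
      (auto simp: measurable_cong_sets[OF C refl] intro!: arg_cong2[where f = emeasure])
  then have tail: "emeasure D {x. b < \<bar>x $ i\<bar>} = emeasure lborel ({0<..<1} \<inter> {y. b < \<bar>2 * y - 1\<bar>})" for b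
    using copula_marginal[OF assms(1), of "{y. b < \<bar>2 * y - 1\<bar>}" i] by simp
  have "{0<..<1} \<inter> {y. 1 < \<bar>2 * y - 1\<bar>} = ({} :: real set)"
    by auto
  then show "emeasure D {x. 1 < \<bar>x $ i\<bar>} = 0"
    by (simp add: tail)
  assume a: "0 \<le> a" "a \<le> 1"
  \<comment> \<open>Two disjoint intervals, one at each end, of length \<open>(1 - a) / 2\<close>
    each.\<close>
  then have "{0<..<1} \<inter> {y. a < \<bar>2 * y - 1\<bar>} = {0<..<(1 - a) / 2} \<union> {(1 + a) / 2<..<1}"
    by (auto simp: abs_if field_simps split: if_splits)
  moreover have "emeasure lborel ({0<..<(1 - a) / 2} \<union> {(1 + a) / 2<..<1}) =
      emeasure lborel {0<..<(1 - a) / 2} + emeasure lborel {(1 + a) / 2<..<1}"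
    using a by (intro plus_emeasure[symmetric]) auto
  ultimately show "emeasure D {x. a < \<bar>x $ i\<bar>} = ennreal (1 - a)"
    using a by (simp add: tail ennreal_plus[symmetric] field_simps del: ennreal_plus)
qed

section \<open>Contradiction between linear tails and caps of higher order\<close>

theorem theorem6:
  fixes p :: real
  assumes "1 \<le> p"
    and "2 \<le> CARD('n::finite)"
    and "\<exists>C :: (real ^ 'n) measure.
           positive_lp_spherical_copula p C \<or> circular_lp_spherical_copula p C"
  shows "real CARD('n) - 1 \<le> p"
proof (rule ccontr)
  assume *: "\<not> real CARD('n) - 1 \<le> p"
  define q where "q = (real CARD('n) - 1) / p"
  have q: "1 < q"
    using * assms(1) by (simp add: q_def)
  fix i :: 'n
  obtain C :: "(real ^ 'n) measure"
    where "positive_lp_spherical_copula p C \<or> circular_lp_spherical_copula p C"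
    using assms(3) by blast
  \<comment> \<open>\<open>D\<close> is the copula itself in the positive case and its image under
    \<open>2 * x $ i - 1\<close> in the circular case; from here on the two cases coincide.\<close>
  then obtain D :: "(real ^ 'n) measure"
    where spherical: "lp_spherical_pos p D \<or> lp_spherical p D"
      and null: "emeasure D {x. 1 < \<bar>x $ i\<bar>} = 0"
      and tail: "\<And>a. 0 \<le> a \<Longrightarrow> a \<le> 1 \<Longrightarrow> emeasure D {x. a < \<bar>x $ i\<bar>} = ennreal (1 - a)"
  proof
    assume "positive_lp_spherical_copula p C"
    then show thesis
      using that[of C] copula_abs_tail[where C = C and i = i]
      by (auto simp: positive_lp_spherical_copula_def)
  next
    assume "circular_lp_spherical_copula p C"
    then show thesis
      using that[of "distr C borel (\<lambda>x. \<chi> i. 2 * x $ i - 1)"] copula_centred_abs_tail[where C = C and i = i]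
      by (auto simp: circular_lp_spherical_copula_def)
  qed
  obtain K where K: "0 < K"
    "\<And>e. 0 < e \<Longrightarrow> e < 1 \<Longrightarrow>
      emeasure (lp_uniform p) {u :: real ^ 'n. 1 - e < \<bar>u $ i\<bar>} \<le> ennreal (K * e powr q)"
    using lp_uniform_cap_bound[OF assms(1), where i = i] unfolding q_def by blast
  \<comment> \<open>The tail of \<open>D\<close> beyond \<open>1 - e\<close> is exactly
    \<open>e\<close>, while the cap has probability at most \<open>K * e powr q\<close>; divide by
    \<open>e\<close>.\<close>
  have bound: "1 \<le> K * e powr (q - 1)" if e: "0 < e" "e < 1" for e
  proof -
    have "ennreal e = emeasure D {x. 1 - e < \<bar>x $ i\<bar>}"
      using tail[of "1 - e"] e by simp
    also have "\<dots> \<le> emeasure (lp_uniform p) {u :: real ^ 'n. 1 - e < \<bar>u $ i\<bar>}"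
      using spherical_uniform_tail_le[OF _ spherical null] assms(1) e by simp
    also have "\<dots> \<le> ennreal (K * e powr q)"
      using K(2) e by simp
    finally have "e \<le> K * e powr q"
      using K(1) by simp
    then show ?thesis
      using e by (simp add: powr_diff field_simps)
  qed
  \<comment> \<open>The exponent \<open>q - 1\<close> is positive, so the right-hand side of
    \<open>bound\<close> tends to \<open>0\<close>, although it stays at least
    \<open>1\<close>.\<close>
  have "((\<lambda>e. K * e powr (q - 1)) \<longlongrightarrow> K * 0 powr (q - 1)) (at_right 0)"
    using q by (intro tendsto_intros tendsto_powr') (auto intro: eventually_mono[OF eventually_at_right_less])
  moreover have "eventually (\<lambda>e. 1 \<le> K * e powr (q - 1)) (at_right 0)"
    using bound by (auto simp: eventually_at_right_field intro!: exI[of _ 1])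
  ultimately have "1 \<le> K * 0 powr (q - 1)"
    by (intro tendsto_lowerbound) auto
  then show False
    by simp
qed

end
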